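(* For every $n\ge1$, there is a Sperner chain decomposition of $L(3,n)$ whose set of starting partitions is $$S_{3,n}=\{(4k+\ell,2k,0): k\in\mathbb{N},\ \ell\in\mathbb{N}\setminus\{1\},\ 4k+\ell\le n,\ 6k+\ell\le 3n/2\}.$$
   Context: $\mathbb{N}=\{0,1,2,\dots\}$. $L(m,n)$ is the poset of integer vectors $\lambda=(\lambda_1,\dots,\lambda_m)$ with $n\ge\lambda_1\ge\cdots\ge\lambda_m\ge0$, ordered componentwise, ranked by $|\lambda|=\sum\lambda_i$. A chain decomposition (partition into disjoint chains) of $L(m,n)$ is called Sperner if each chain $x_{1}<\cdots<x_{e}$ satisfies $|x_1|\le mn/2\le |x_e|$ and contains an element of rank $\lfloor mn/2\rfloor$; the smallest elements $x_1$ of the chains are the starting partitions. *)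

theory Defs
  imports Complex_Main "HOL-Library.Disjoint_Sets"
begin

text \<open>A vector \<open>(\<lambda>\<^sub>1, \<dots>, \<lambda>\<^sub>m)\<close> is the list of its entries; its rank \<open>|\<lambda>|\<close> is \<open>sum_list\<close>.\<close>

definition L :: "nat \<Rightarrow> nat \<Rightarrow> nat list set" where
  "L m n = {v. length v = m \<and> sorted_wrt (\<ge>) v \<and> (\<forall>a\<in>set v. a \<le> n)}"

text \<open>Lists carry no componentwise \<open>\<le>\<close> by default, so the order is named explicitly.\<close>

abbreviation cw_le :: "nat list \<Rightarrow> nat list \<Rightarrow> bool" where
  "cw_le \<equiv> list_all2 (\<le>)"

definition least_in :: "nat list \<Rightarrow> nat list set \<Rightarrow> bool" where
  "least_in x C \<longleftrightarrow> x \<in> C \<and> (\<forall>y\<in>C. cw_le x y)"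

definition greatest_in :: "nat list \<Rightarrow> nat list set \<Rightarrow> bool" where
  "greatest_in x C \<longleftrightarrow> x \<in> C \<and> (\<forall>y\<in>C. cw_le y x)"

text \<open>The blocks of \<open>partition_on\<close> are nonempty.  Chains need not be saturated.\<close>

definition chain_decomposition :: "nat \<Rightarrow> nat \<Rightarrow> nat list set set \<Rightarrow> bool" where
  "chain_decomposition m n P \<longleftrightarrow>
     partition_on (L m n) P \<and> (\<forall>C\<in>P. Complete_Partial_Order.chain cw_le C)"

definition sperner_decomposition :: "nat \<Rightarrow> nat \<Rightarrow> nat list set set \<Rightarrow> bool" where
  "sperner_decomposition m n P \<longleftrightarrow>
     chain_decomposition m n P \<and>
     (\<forall>C\<in>P. (\<exists>x. least_in x C \<and> real (sum_list x) \<le> real (m * n) / 2) \<and>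
            (\<exists>y. greatest_in y C \<and> real (m * n) / 2 \<le> real (sum_list y)) \<and>
            (\<exists>z\<in>C. int (sum_list z) = \<lfloor>real (m * n) / 2\<rfloor>))"

definition starting_partitions :: "nat list set set \<Rightarrow> nat list set" where
  "starting_partitions P = {x. \<exists>C\<in>P. least_in x C}"

definition S3 :: "nat \<Rightarrow> nat list set" where
  "S3 n = {[4 * k + l, 2 * k, 0] | k l. l \<noteq> 1 \<and> 4 * k + l \<le> n \<and>
             real (6 * k + l) \<le> 3 * real n / 2}"

end

theory Submission
  imports Defs
begin

text \<open>
  \<^bold>\<open>Idea.\<close>  Translation by \<open>(4, 2, 0)\<close> embeds \<open>L(3, n - 4)\<close> into \<open>L(3, n)\<close>: the image consists of the
  vectors \<open>(a, b, c)\<close> with \<open>a - b \<ge> 2\<close> and \<open>b - c \<ge> 2\<close>.  The translation preserves the order, and it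
  raises ranks by 6, which is exactly the difference between the middle ranks \<open>3(n - 4)/2\<close> and
  \<open>3n/2\<close>.  So it is enough to decompose the rest of \<open>L(3, n)\<close>, the vectors with
  \<open>a - b \<le> 1\<close> or \<open>b - c \<le> 1\<close>, into chains that start at \<open>(l, 0, 0)\<close> for \<open>l \<noteq> 1\<close>, pass through the
  middle rank and end above it; the \<open>k\<close>-fold translates of these chains then start at
  \<open>(4k + l, 2k, 0)\<close>.

  The rest decomposes into chains along which each step increases one entry by 1:

  \<^item> for \<open>l = 0\<close>, the chain
    \<open>(0,0,0), (1,0,0), (1,1,0), (1,1,1), (2,1,1), \<dots>, (n,n,n)\<close>
    of all vectors with \<open>a - c \<le> 1\<close>;
  \<^item> for \<open>l \<ge> 2\<close>, first the two smaller entries grow alternately while \<open>a = l\<close> stays fixed,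
    \<open>(l,0,0), (l,1,0), (l,1,1), (l,2,1), \<dots>, (l,l-1,l-2)\<close>, and then the two larger ones grow
    alternately while \<open>c = l - 2\<close> stays fixed, \<open>(l,l,l-2), (l+1,l,l-2), \<dots>, (n,n,l-2)\<close>.

  The first phases contain every vector with \<open>b - c \<le> 1\<close> and \<open>a - c \<ge> 2\<close> (with \<open>l = a\<close>), the second
  phases every vector with \<open>a - b \<le> 1\<close> and \<open>b - c \<ge> 2\<close> (with \<open>l = c + 2\<close>).  The end
  \<open>(n, n, l - 2)\<close> has rank at least \<open>2n\<close>, and the start rank \<open>l\<close> is at most \<open>n\<close>, so the middle rank
  is hit on the way; for \<open>l = 0\<close> the chain runs through all ranks from \<open>0\<close> to \<open>3n\<close>.
\<close>

section \<open>The chains before translation\<close>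

text \<open>
  The entry \<open>a\<close> is not bounded here: the bound \<open>n\<close> only cuts off the end of each of
  these infinite chains, because \<open>a\<close> never decreases along them.  For \<open>l = 1\<close> there is no chain, since
  \<open>(1, 0, 0)\<close> lies above \<open>(0, 0, 0)\<close> in the chain of \<open>l = 0\<close>.
\<close>

definition on_curve :: "nat \<Rightarrow> nat \<Rightarrow> nat \<Rightarrow> nat \<Rightarrow> bool" where
  "on_curve l a b c \<longleftrightarrow>
     (l = 0 \<and> c \<le> b \<and> b \<le> a \<and> a \<le> c + 1) \<or>
     (2 \<le> l \<and> a = l \<and> c \<le> b \<and> b \<le> c + 1 \<and> c + 2 \<le> l) \<or>
     (2 \<le> l \<and> c + 2 = l \<and> l \<le> b \<and> b \<le> a \<and> a \<le> b + 1)"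

lemma on_curve_start: "l \<noteq> 1 \<Longrightarrow> on_curve l l 0 0"
  by (auto simp: on_curve_def)

lemma on_curve_ge_start: "on_curve l a b c \<Longrightarrow> l \<le> a"
  by (auto simp: on_curve_def)

lemma on_curve_decreasing: "on_curve l a b c \<Longrightarrow> c \<le> b \<and> b \<le> a"
  by (auto simp: on_curve_def)

lemma on_curve_small_gap: "on_curve l a b c \<Longrightarrow> a \<le> b + 1 \<or> b \<le> c + 1"
  by (auto simp: on_curve_def)

lemma on_curve_index_ne_1: "on_curve l a b c \<Longrightarrow> l \<noteq> 1"
  by (auto simp: on_curve_def)

lemma on_curve_index_unique: "on_curve l a b c \<Longrightarrow> on_curve l' a b c \<Longrightarrow> l = l'"
  by (auto simp: on_curve_def)

lemma on_curve_covers_small_gap: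
  assumes "c \<le> b" "b \<le> a" "a \<le> b + 1 \<or> b \<le> c + 1"
  obtains l where "on_curve l a b c"
proof -
  have "on_curve (if a \<le> c + 1 then 0 else if b \<le> c + 1 then a else c + 2) a b c"
    using assms by (auto simp: on_curve_def)
  then show thesis by (rule that)
qed

lemma on_curve_comparable:
  assumes "on_curve l a b c" "on_curve l a' b' c'"
  shows "(a \<le> a' \<and> b \<le> b' \<and> c \<le> c') \<or> (a' \<le> a \<and> b' \<le> b \<and> c' \<le> c)"
  using assms unfolding on_curve_def by (elim disjE conjE) auto

text \<open>
  Each step along the curve from \<open>(l, 0, 0)\<close> raises the rank by 1, so the curve meets every rank
  \<open>r \<ge> l\<close>.  For \<open>l \<le> N\<close> its first entry exceeds \<open>N\<close> only after some \<open>(N, N, c)\<close>, of rank at least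
  \<open>2N\<close>, so cutting the curve at \<open>N\<close> keeps all its points of rank at most \<open>3N/2\<close>.
\<close>

lemma on_curve_rank:
  assumes "l \<noteq> 1" "l \<le> r" "l \<le> N" "2 * r \<le> 3 * N"
  obtains a b c where "on_curve l a b c" "a + b + c = r" "a \<le> N"
proof -
  consider "l = 0" | "2 \<le> l" "r \<le> 3 * l - 3" | "2 \<le> l" "3 * l - 2 \<le> r"
    using assms(1) by linarith
  then show thesis
  proof cases
    case 1
    \<comment> \<open>Distribute \<open>r\<close> as evenly as possible over the three entries.\<close>
    define q where "q = r div 3"
    have "3 * q \<le> r" "r < 3 * q + 3" unfolding q_def by linarith+
    then consider "r = 3 * q" | "r = 3 * q + 1" | "r = 3 * q + 2" by linarith
    then show thesis
    proof cases
      case r: 1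
      show thesis by (rule that[of q q q]) (use 1 r assms(4) in \<open>auto simp: on_curve_def\<close>)
    next
      case r: 2
      show thesis by (rule that[of "q + 1" q q]) (use 1 r assms(4) in \<open>auto simp: on_curve_def\<close>)
    next
      case r: 3
      show thesis by (rule that[of "q + 1" "q + 1" q]) (use 1 r assms(4) in \<open>auto simp: on_curve_def\<close>)
    qed
  next
    case 2
    \<comment> \<open>First phase: distribute \<open>r - l\<close> evenly over the two smaller entries.\<close>
    define q where "q = (r - l) div 2"
    have "2 * q \<le> r - l" "r - l < 2 * q + 2" unfolding q_def by linarith+
    with assms(2) consider "r = l + 2 * q" | "r = l + 2 * q + 1" by linarith
    then show thesis
    proof cases
      case r: 1
      show thesis by (rule that[of l q q]) (use 2 r assms(3) in \<open>auto simp: on_curve_def\<close>)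
    next
      case r: 2
      show thesis by (rule that[of l "q + 1" q]) (use 2 r assms(3) in \<open>auto simp: on_curve_def\<close>)
    qed
  next
    case 3
    \<comment> \<open>Second phase: distribute \<open>r - (l - 2)\<close> evenly over the two larger entries.\<close>
    obtain m where m: "l = m + 2" using 3 by (metis add.commute le_Suc_ex)
    define q where "q = (r - m) div 2"
    have "2 * q \<le> r - m" "r - m < 2 * q + 2" unfolding q_def by linarith+
    with assms(2) m consider "r = m + 2 * q" | "r = m + 2 * q + 1" by linarith
    then show thesis
    proof cases
      case r: 1
      show thesis by (rule that[of q q m]) (use 3 r m assms(3,4) in \<open>auto simp: on_curve_def\<close>)
    next
      case r: 2
      show thesis by (rule that[of "q + 1" q m]) (use 3 r m assms(3,4) in \<open>auto simp: on_curve_def\<close>)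
    qed
  qed
qed

section \<open>The translated chains\<close>

definition strand :: "nat \<Rightarrow> nat \<Rightarrow> nat \<Rightarrow> nat list set" where
  "strand n k l = {[4 * k + a, 2 * k + b, c] | a b c. on_curve l a b c \<and> 4 * k + a \<le> n}"

definition strands :: "nat \<Rightarrow> nat list set set" where
  "strands n = {strand n k l | k l. l \<noteq> 1 \<and> 4 * k + l \<le> n}"

lemma cw_le_triple: "cw_le [a, b, c] [a', b', c'] \<longleftrightarrow> a \<le> a' \<and> b \<le> b' \<and> c \<le> c'"
  by simp

lemma L_3_iff: "v \<in> L 3 n \<longleftrightarrow> (\<exists>a b c. v = [a, b, c] \<and> c \<le> b \<and> b \<le> a \<and> a \<le> n)"
  by (auto simp: L_def length_Suc_conv numeral_3_eq_3)

text \<open>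
  A curve point cannot be translated back by \<open>(4, 2, 0)\<close>, so the shift \<open>k\<close> of a translated curve point
  \<open>(a, b, c)\<close> is determined as \<open>min \<lfloor>(a - b)/2\<rfloor> \<lfloor>(b - c)/2\<rfloor>\<close>.
\<close>

lemma shift_unique:
  assumes "on_curve l a b c"
  shows "min ((4 * k + a - (2 * k + b)) div 2) ((2 * k + b - c) div 2) = k"
proof -
  have "4 * k + a - (2 * k + b) = a - b + 2 * k" "2 * k + b - c = b - c + 2 * k"
    using on_curve_decreasing[OF assms] by linarith+
  moreover have "(a - b) div 2 = 0 \<or> (b - c) div 2 = 0"
    using on_curve_small_gap[OF assms] by auto
  ultimately show ?thesis by auto
qed

lemma strand_index_unique:
  assumes "v \<in> strand n k l" "v \<in> strand n k' l'"
  shows "k = k' \<and> l = l'"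
proof -
  obtain a b c where v: "v = [4 * k + a, 2 * k + b, c]" and p: "on_curve l a b c"
    using assms(1) by (auto simp: strand_def)
  obtain a' b' c' where v': "v = [4 * k' + a', 2 * k' + b', c']" and p': "on_curve l' a' b' c'"
    using assms(2) by (auto simp: strand_def)
  have eqs: "4 * k + a = 4 * k' + a'" "2 * k + b = 2 * k' + b'" "c = c'"
    using v v' by auto
  have "k = k'"
    using shift_unique[OF p, of k] shift_unique[OF p', of k'] unfolding eqs by simp
  then show ?thesis using eqs p p' on_curve_index_unique by auto
qed

lemma strands_cover: "\<Union> (strands n) = L 3 n"
proof (rule set_eqI, rule iffI)
  fix v assume "v \<in> \<Union> (strands n)"
  then obtain k l a b c where "v = [4 * k + a, 2 * k + b, c]" "on_curve l a b c" "4 * k + a \<le> n"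
    by (auto simp: strands_def strand_def)
  then show "v \<in> L 3 n"
    using on_curve_decreasing[of l a b c] by (auto simp: L_3_iff)
next
  fix v assume "v \<in> L 3 n"
  then obtain a b c where v: "v = [a, b, c]" "c \<le> b" "b \<le> a" "a \<le> n"
    by (auto simp: L_3_iff)
  \<comment> \<open>Translate back by \<open>(4, 2, 0)\<close> as often as both gaps allow.\<close>
  define k where "k = min ((a - b) div 2) ((b - c) div 2)"
  have k: "2 * k \<le> a - b" "2 * k \<le> b - c" "a - b \<le> 2 * k + 1 \<or> b - c \<le> 2 * k + 1"
    unfolding k_def by linarith+
  obtain l where l: "on_curve l (a - 4 * k) (b - 2 * k) c"
  proof (rule on_curve_covers_small_gap)
    show "c \<le> b - 2 * k" "b - 2 * k \<le> a - 4 * k"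
      "a - 4 * k \<le> b - 2 * k + 1 \<or> b - 2 * k \<le> c + 1"
      using k v by linarith+
  qed
  have "v = [4 * k + (a - 4 * k), 2 * k + (b - 2 * k), c]" "4 * k + (a - 4 * k) = a"
    using k v by auto
  then have "v \<in> strand n k l" using l v(4) unfolding strand_def mem_Collect_eq by metis
  moreover have "l \<noteq> 1" "4 * k + l \<le> n"
    using on_curve_index_ne_1[OF l] on_curve_ge_start[OF l] k v by linarith+
  ultimately show "v \<in> \<Union> (strands n)" by (auto simp: strands_def)
qed

lemma strand_chain: "Complete_Partial_Order.chain cw_le (strand n k l)"
proof (rule chainI)
  fix v w assume "v \<in> strand n k l" "w \<in> strand n k l"
  then obtain a b c a' b' c' where
    "v = [4 * k + a, 2 * k + b, c]" "on_curve l a b c"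
    "w = [4 * k + a', 2 * k + b', c']" "on_curve l a' b' c'"
    by (auto simp: strand_def)
  then show "cw_le v w \<or> cw_le w v"
    using on_curve_comparable[of l a b c a' b' c'] by auto
qed

lemma strand_least:
  assumes "l \<noteq> 1" "4 * k + l \<le> n"
  shows "least_in [4 * k + l, 2 * k, 0] (strand n k l)"
proof -
  have "[4 * k + l, 2 * k, 0] \<in> strand n k l"
    using on_curve_start[OF assms(1)] assms(2) by (force simp: strand_def)
  then show ?thesis
    using on_curve_ge_start by (fastforce simp: least_in_def strand_def)
qed

lemma strand_greatest:
  assumes "l \<noteq> 1" "4 * k + l \<le> n"
  obtains c where "greatest_in [n, n - 2 * k, c] (strand n k l)"
proof -
  define N where "N = n - 4 * k"
  have N: "n = 4 * k + N" "n - 2 * k = 2 * k + N" "l \<le> N"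
    using assms(2) by (auto simp: N_def)
  define c where "c = (if l = 0 then N else l - 2)"
  have top: "on_curve l N N c"
    using assms(1) N(3) by (auto simp: on_curve_def c_def)
  have "b' \<le> N \<and> c' \<le> c" if "on_curve l a' b' c'" "a' \<le> N" for a' b' c'
    using that by (auto simp: on_curve_def c_def)
  then have "greatest_in [n, n - 2 * k, c] (strand n k l)"
    using top unfolding greatest_in_def strand_def N by auto
  then show thesis by (rule that)
qed

lemma strand_middle:
  assumes "l \<noteq> 1" "4 * k + l \<le> n"
  obtains z where "z \<in> strand n k l" "sum_list z = 3 * n div 2"
proof -
  \<comment> \<open>The strand is the \<open>k\<close>-fold translate of a chain in \<open>L(3, n - 4k)\<close>, whose middle rank is \<open>6k\<close> lower.\<close>
  define N where "N = n - 4 * k"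
  have N: "n = 4 * k + N" "l \<le> N" using assms(2) by (auto simp: N_def)
  have "l \<le> 3 * N div 2" "2 * (3 * N div 2) \<le> 3 * N" using N(2) by linarith+
  then obtain a b c where p: "on_curve l a b c" "a + b + c = 3 * N div 2" "a \<le> N"
    using on_curve_rank[of l "3 * N div 2" N] assms(1) N(2) by metis
  have "[4 * k + a, 2 * k + b, c] \<in> strand n k l"
    using p N by (auto simp: strand_def)
  moreover have "sum_list [4 * k + a, 2 * k + b, c] = 3 * n div 2"
    using p(2) N(1) by simp
  ultimately show thesis by (rule that)
qed

lemma least_in_unique:
  assumes "least_in x C" "least_in y C"
  shows "x = y"
proof -
  have "cw_le x y" "cw_le y x" using assms by (auto simp: least_in_def)
  then show ?thesis by (rule list_all2_antisym[rotated]) simp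
qed

section \<open>The decomposition\<close>

text \<open>
  Since \<open>2 (6k + l) \<le> 3 (4k + l)\<close>, every vector \<open>(4k + l, 2k, 0)\<close> with \<open>4k + l \<le> n\<close> lies at or below
  the middle of \<open>L(3, n)\<close>.
\<close>

lemma S3_eq: "S3 n = {[4 * k + l, 2 * k, 0] | k l. l \<noteq> 1 \<and> 4 * k + l \<le> n}"
proof -
  have "real (6 * k + l) \<le> 3 * real n / 2" if "4 * k + l \<le> n" for k l
    using of_nat_mono[OF that, where 'a = real] by simp
  then show ?thesis unfolding S3_def by blast
qed

lemma strands_chain_decomposition: "chain_decomposition 3 n (strands n)"
proof -
  have "disjoint (strands n)"
  proof (rule disjointI)
    fix C D assume "C \<in> strands n" "D \<in> strands n" "C \<noteq> D"
    then show "C \<inter> D = {}"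
      unfolding strands_def using strand_index_unique by blast
  qed
  moreover have "{} \<notin> strands n"
    using strand_least by (fastforce simp: strands_def least_in_def)
  ultimately have "partition_on (L 3 n) (strands n)"
    by (simp add: partition_on_def strands_cover)
  then show ?thesis
    using strand_chain by (auto simp: chain_decomposition_def strands_def)
qed

lemma strands_sperner: "sperner_decomposition 3 n (strands n)"
  unfolding sperner_decomposition_def
proof (intro conjI ballI strands_chain_decomposition)
  fix C assume "C \<in> strands n"
  then obtain k l where C: "C = strand n k l" and kl: "l \<noteq> 1" "4 * k + l \<le> n"
    by (auto simp: strands_def)
  have "real (sum_list [4 * k + l, 2 * k, 0]) \<le> real (3 * n) / 2"
    using of_nat_mono[OF kl(2), where 'a = real] by simp
  then show "\<exists>x. least_in x C \<and> real (sum_list x) \<le> real (3 * n) / 2"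
    using strand_least[OF kl] C by blast
  obtain c where c: "greatest_in [n, n - 2 * k, c] C"
    using strand_greatest[OF kl] C by blast
  \<comment> \<open>The second entry \<open>n - 2k\<close> is at least \<open>n/2\<close>, because \<open>4k \<le> n\<close>.\<close>
  have "3 * n \<le> 2 * sum_list [n, n - 2 * k, c]"
    using kl(2) by simp
  then have "real (3 * n) / 2 \<le> real (sum_list [n, n - 2 * k, c])"
    by linarith
  then show "\<exists>y. greatest_in y C \<and> real (3 * n) / 2 \<le> real (sum_list y)"
    using c by blast
  obtain z where "z \<in> C" "sum_list z = 3 * n div 2"
    using strand_middle[OF kl] C by blast
  moreover have "int (3 * n div 2) = \<lfloor>real (3 * n) / 2\<rfloor>"
    by (metis floor_divide_of_nat_eq of_nat_numeral)
  ultimately show "\<exists>z\<in>C. int (sum_list z) = \<lfloor>real (3 * n) / 2\<rfloor>" by metis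
qed

lemma strands_start: "starting_partitions (strands n) = S3 n"
proof (rule set_eqI)
  fix x
  have "x \<in> starting_partitions (strands n) \<longleftrightarrow>
      (\<exists>k l. l \<noteq> 1 \<and> 4 * k + l \<le> n \<and> least_in x (strand n k l))"
    by (auto simp: starting_partitions_def strands_def)
  also have "\<dots> \<longleftrightarrow> (\<exists>k l. l \<noteq> 1 \<and> 4 * k + l \<le> n \<and> x = [4 * k + l, 2 * k, 0])"
    using strand_least least_in_unique by metis
  also have "\<dots> \<longleftrightarrow> x \<in> S3 n"
    by (auto simp: S3_eq)
  finally show "x \<in> starting_partitions (strands n) \<longleftrightarrow> x \<in> S3 n" .
qed

theorem proposition23:
  fixes n :: nat
  assumes "n \<ge> 1"
  shows "\<exists>P. sperner_decomposition 3 n P \<and> starting_partitions P = S3 n"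
  using strands_sperner strands_start by blast

end
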